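(* Let $d$ be a positive integer and $\varepsilon>0$, and set $m=d\cdot n(d,\varepsilon)$. If $X_1,X_2,\ldots,X_m$ are sets in $\mathbb{R}^d$ and $K\subset\bigcap_{i=1}^m \operatorname{conv}(X_i)$ is a convex set of volume $1$, then one can choose $x_1\in X_1, x_2\in X_2,\ldots,x_m\in X_m$ such that $$\operatorname{vol}(\operatorname{conv}\{x_1,x_2,\ldots,x_m\})\ge 1-\varepsilon.$$ Moreover, if $m$ is instead any positive integer with $m<n(d,\varepsilon)$, the conclusion may fail: there exist sets $X_1,\ldots,X_m\subset\mathbb{R}^d$ and a convex set $K\subset\bigcap_{i=1}^m\operatorname{conv}(X_i)$ of volume $1$ such that every choice $x_1\in X_1,\ldots,x_m\in X_m$ satisfies $\operatorname{vol}(\operatorname{conv}\{x_1,\ldots,x_m\})<1-\varepsilon$.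
   Context: For a positive integer $d$ and $\varepsilon>0$, $n(d,\varepsilon)$ denotes the smallest integer such that, for any convex set $K\subset\mathbb{R}^d$ with positive finite volume, there is a polytope $P\subset K$ with at most $n(d,\varepsilon)$ vertices such that $\operatorname{vol}(P)\ge(1-\varepsilon)\operatorname{vol}(K)$. A polytope is the convex hull of finitely many points; $\operatorname{vol}$ is $d$-dimensional volume and $\operatorname{conv}$ is the convex hull. *)

theory Defs
  imports "HOL-Analysis.Analysis"
begin

(* Volume is Lebesgue measure rather than lborel because a convex set need not be Borel;
   it is always Lebesgue measurable. The dimension d is CARD('d). *)

abbreviation vol :: "(real ^ 'd) set \<Rightarrow> real" where
  "vol S \<equiv> measure lebesgue S"

(* The vertices of a polytope are its extreme points. Since LEAST is unspecified on an empty
   set of candidates, using the defining property of this number requires knowing that some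
   n works for all K simultaneously. *)

definition vertex_bound :: "'d::finite itself \<Rightarrow> real \<Rightarrow> nat" where
  "vertex_bound (_ :: 'd itself) \<epsilon> =
    (LEAST n. \<forall>K :: (real ^ 'd) set. convex K \<and> K \<in> lmeasurable \<and> vol K > 0 \<longrightarrow>
      (\<exists>P. polytope P \<and> P \<subseteq> K \<and> card {v. v extreme_point_of P} \<le> n \<and>
           vol P \<ge> (1 - \<epsilon>) * vol K))"

end

theory Submission
  imports Defs
begin

text \<open>
  Let \<open>P\<close> be an optimal polytope inside \<open>K\<close> with \<open>n\<close> vertices, fix a point \<open>q\<close> in its interior and assign
  \<open>d\<close> of the sets \<open>X\<^sub>i\<close> to each vertex \<open>v\<close>. Barany's form of the colourful Caratheodory theorem selects one
  point from each of these \<open>d\<close> sets so that \<open>v\<close> lies in the convex hull of \<open>q\<close> and the selected points.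
  Hence \<open>P\<close> lies in the hull of \<open>q\<close> and all selected points; as \<open>q\<close> is interior to this hull, it is not an
  extreme point of it and can be dropped.

  The number \<open>n(d,\<epsilon>)\<close> is meaningful because a suitable affine map puts the body between the standard simplex
  and the cube \<open>[-1,1]\<^sup>d\<close>. There, the points of the body in one fixed finite net, depending only on \<open>d\<close> and \<open>\<epsilon>\<close>,
  span a polytope that contains a slightly shrunken copy of the body.

  For \<open>m < n(d,\<epsilon>)\<close> take all \<open>X\<^sub>i\<close> equal to \<open>K\<close>, a badly approximable convex set rescaled to volume 1.
\<close>

section \<open>The colourful Caratheodory theorem: a conic version, then a version with a fixed
  point \<open>q\<close>\<close>

lemma convex_cone_hull_image_finite:
  fixes x :: "'i \<Rightarrow> 'a::real_vector"
  assumes "finite I"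
  shows "convex_cone hull (x ` I) = {\<Sum>i\<in>I. c i *\<^sub>R x i | c. \<forall>i\<in>I. 0 \<le> c i}" (is "_ = ?R")
proof
  show "convex_cone hull (x ` I) \<subseteq> ?R"
  proof (rule hull_minimal)
    show "x ` I \<subseteq> ?R"
    proof clarify
      fix k assume "k \<in> I"
      then show "\<exists>c. x k = (\<Sum>i\<in>I. c i *\<^sub>R x i) \<and> (\<forall>i\<in>I. 0 \<le> c i)"
        using assms by (intro exI[of _ "\<lambda>i. if i = k then 1 else 0"]) (simp add: if_distrib[of "\<lambda>c. c *\<^sub>R _"] cong: if_cong)
    qed
    show "convex_cone ?R"
      unfolding convex_cone_iff
    proof (intro conjI ballI allI impI)
      show "0 \<in> ?R" by (auto intro!: exI[of _ "\<lambda>_. 0"])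
    next
      fix a b assume "a \<in> ?R" "b \<in> ?R"
      then obtain c d where "a = (\<Sum>i\<in>I. c i *\<^sub>R x i)" "\<forall>i\<in>I. 0 \<le> c i"
        "b = (\<Sum>i\<in>I. d i *\<^sub>R x i)" "\<forall>i\<in>I. 0 \<le> d i" by auto
      then show "a + b \<in> ?R"
        by (auto intro!: exI[of _ "\<lambda>i. c i + d i"] simp: scaleR_left_distrib sum.distrib)
    next
      fix a and r :: real assume "a \<in> ?R" "0 \<le> r"
      then obtain c where "a = (\<Sum>i\<in>I. c i *\<^sub>R x i)" "\<forall>i\<in>I. 0 \<le> c i" by auto
      with \<open>0 \<le> r\<close> show "r *\<^sub>R a \<in> ?R"
        by (auto intro!: exI[of _ "\<lambda>i. r * c i"] simp: scaleR_sum_right)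
    qed
  qed
  show "?R \<subseteq> convex_cone hull (x ` I)"
  proof clarify
    fix c :: "'i \<Rightarrow> real" assume c: "\<forall>i\<in>I. 0 \<le> c i"
    from assms c show "(\<Sum>i\<in>I. c i *\<^sub>R x i) \<in> convex_cone hull (x ` I)"
    proof (induction I)
      case empty
      then show ?case by simp
    next
      case (insert j J)
      have "c j *\<^sub>R x j \<in> convex_cone hull (x ` insert j J)"
        using insert by (intro convex_cone_hull_mul hull_inc) auto
      moreover have "(\<Sum>i\<in>J. c i *\<^sub>R x i) \<in> convex_cone hull (x ` insert j J)"
        using insert hull_mono[of "x ` J" "x ` insert j J" convex_cone] by auto
      ultimately show ?case using insert by (simp add: convex_cone_hull_add)
    qed
  qed
qed

text \<open>Indices are counted rather than points, because different colours may select the same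
  point; a repetition \<open>x j = x k\<close> is itself a dependence. A change of sign makes one
  coefficient positive, as the ratio argument in \<open>conic_drop_generator\<close>
  requires.\<close>

lemma family_linear_dependence:
  fixes x :: "'i \<Rightarrow> 'a::euclidean_space"
  assumes "finite I" "dim (x ` I) < card I"
  obtains \<mu> k where "(\<Sum>i\<in>I. \<mu> i *\<^sub>R x i) = 0" "k \<in> I" "\<mu> k > (0::real)"
proof -
  obtain \<nu> k where \<nu>: "(\<Sum>i\<in>I. \<nu> i *\<^sub>R x i) = 0" "k \<in> I" "\<nu> k \<noteq> (0::real)"
  proof (cases "inj_on x I")
    case True
    then have "dependent (x ` I)"
      using assms by (intro dependent_biggerset_general) (simp add: card_image)
    then obtain w where w: "(\<Sum>v\<in>x ` I. w v *\<^sub>R v) = 0" "\<exists>v\<in>x ` I. w v \<noteq> 0"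
      using assms(1) dependent_finite[of "x ` I"] by auto
    then obtain k where "k \<in> I" "w (x k) \<noteq> 0" by auto
    then show ?thesis
      using that[of "w \<circ> x" k] w True by (simp add: sum.reindex)
  next
    case False
    then obtain j k where jk: "j \<in> I" "k \<in> I" "j \<noteq> k" "x j = x k"
      by (auto simp: inj_on_def)
    define \<nu> :: "'i \<Rightarrow> real" where "\<nu> i = (if i = k then 1 else 0) - (if i = j then 1 else 0)" for i
    have "(\<Sum>i\<in>I. \<nu> i *\<^sub>R x i) = x k - x j"
      using assms(1) jk unfolding \<nu>_def scaleR_left_diff_distrib sum_subtractf
      by (simp add: if_distrib[of "\<lambda>c. c *\<^sub>R _"] cong: if_cong)
    then show ?thesis
      using that[of \<nu> k] jk by (simp add: \<nu>_def)
  qed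
  show ?thesis
  proof (cases "\<nu> k > 0")
    case True
    then show ?thesis using that \<nu> by blast
  next
    case False
    then show ?thesis using that[of "\<lambda>i. - \<nu> i" k] \<nu> by (simp add: sum_negf)
  qed
qed

text \<open>If all coefficients of \<open>z\<close> are positive, then
  \<open>u \<bullet> z = 0\<close> and the sign condition put every \<open>x i\<close> into the
  hyperplane orthogonal to \<open>u\<close>. The generators are then dependent, and the exchange
  from the conic Caratheodory theorem eliminates one of them.\<close>

lemma conic_drop_generator:
  fixes x :: "'i \<Rightarrow> 'a::euclidean_space"
  assumes I: "finite I" "card I = DIM('a)"
    and z: "z \<in> convex_cone hull (x ` I)"
    and u: "u \<noteq> 0" "u \<bullet> z = 0" "\<And>i. i \<in> I \<Longrightarrow> u \<bullet> x i \<le> 0"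
  obtains k where "k \<in> I" "z \<in> convex_cone hull (x ` (I - {k}))"
proof -
  obtain c where c: "z = (\<Sum>i\<in>I. c i *\<^sub>R x i)" "\<forall>i\<in>I. 0 \<le> c i"
    using z unfolding convex_cone_hull_image_finite[OF I(1)] by auto
  note result = that
  have drop: thesis if "k \<in> I" "z = (\<Sum>i\<in>I. b i *\<^sub>R x i)" "\<forall>i\<in>I. 0 \<le> b i" "b k = 0" for b k
  proof (rule result)
    show "k \<in> I" by fact
    have "z = (\<Sum>i\<in>I - {k}. b i *\<^sub>R x i)"
      using \<open>finite I\<close> that by (simp add: sum.remove)
    with that show "z \<in> convex_cone hull (x ` (I - {k}))"
      using I by (subst convex_cone_hull_image_finite) (auto intro!: exI[of _ b])
  qed
  show thesis
  proof (cases "\<exists>k\<in>I. c k = 0")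
    case True
    then show thesis using drop c by blast
  next
    case False
    then have pos: "c i > 0" if "i \<in> I" for i using c(2) that by force
    have "(\<Sum>i\<in>I. c i * (u \<bullet> x i)) = 0"
      using u(2) c(1) by (simp add: inner_sum_right)
    then have "(\<Sum>i\<in>I. - (c i * (u \<bullet> x i))) = 0"
      by (simp add: sum_negf)
    moreover have "0 \<le> - (c i * (u \<bullet> x i))" if "i \<in> I" for i
      using u(3)[OF that] pos[OF that] by (simp add: mult_nonneg_nonpos)
    ultimately have "\<forall>i\<in>I. - (c i * (u \<bullet> x i)) = 0"
      by (subst (asm) sum_nonneg_eq_0_iff) (use I in auto)
    then have "u \<bullet> x i = 0" if "i \<in> I" for i
      using pos[OF that] that by force
    then have "dim (x ` I) \<le> dim {y. u \<bullet> y = 0}"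
      by (intro dim_subset) auto
    also have "\<dots> = DIM('a) - 1" using u(1) by (rule dim_hyperplane)
    finally have "dim (x ` I) < card I" using I DIM_positive[where 'a='a] by linarith
    then obtain \<mu> j where \<mu>: "(\<Sum>i\<in>I. \<mu> i *\<^sub>R x i) = 0" "j \<in> I" "\<mu> j > (0::real)"
      using family_linear_dependence I(1) by blast
    let ?J = "{i\<in>I. \<mu> i > 0}"
    have "finite ?J" "?J \<noteq> {}" using I \<mu> by auto
    \<comment> \<open>The smallest ratio is the largest multiple of the dependence that can be
      subtracted while all coefficients stay nonnegative; the coefficient at \<open>k\<close>
      becomes 0.\<close>
    then obtain k where k: "k \<in> ?J" "\<And>i. i \<in> ?J \<Longrightarrow> c k / \<mu> k \<le> c i / \<mu> i"
      using ex_is_arg_min_if_finite[of ?J "\<lambda>i. c i / \<mu> i"] unfolding is_arg_min_linorder by blast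
    define t where "t = c k / \<mu> k"
    have "t \<ge> 0" using k c(2) by (simp add: t_def)
    show thesis
    proof (rule drop)
      show "k \<in> I" using k by auto
      show "z = (\<Sum>i\<in>I. (c i - t * \<mu> i) *\<^sub>R x i)"
        using \<mu>(1) c(1)
        by (simp add: scaleR_left_diff_distrib sum_subtractf flip: scaleR_scaleR scaleR_sum_right)
      show "\<forall>i\<in>I. 0 \<le> c i - t * \<mu> i"
      proof
        fix i assume i: "i \<in> I"
        show "0 \<le> c i - t * \<mu> i"
        proof (cases "\<mu> i > 0")
          case True
          then have "t \<le> c i / \<mu> i" using k(2)[of i] i by (simp add: t_def)
          then show ?thesis using True by (simp add: field_simps)
        next
          case False
          then have "t * \<mu> i \<le> 0" using \<open>t \<ge> 0\<close> by (simp add: mult_nonneg_nonpos)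
          then show ?thesis using c(2) i by force
        qed
      qed
      show "c k - t * \<mu> k = 0" using k by (simp add: t_def)
    qed
  qed
qed

lemma colorful_caratheodory_cone:
  fixes V :: "'i \<Rightarrow> 'a::euclidean_space set"
  assumes I: "finite I" "card I = DIM('a)"
    and V: "\<And>i. i \<in> I \<Longrightarrow> finite (V i)" "\<And>i. i \<in> I \<Longrightarrow> a \<in> convex hull (V i)"
  obtains x where "x \<in> PiE I V" "a \<in> convex_cone hull (x ` I)"
proof -
  let ?C = "\<lambda>x. convex_cone hull (x ` I)"
  have cl: "closed (?C x)" for x :: "'i \<Rightarrow> 'a" using I by (simp add: closed_convex_cone_hull)
  have ne: "?C x \<noteq> {}" for x :: "'i \<Rightarrow> 'a" by (simp add: convex_cone_hull_nonempty)
  have "V i \<noteq> {}" if "i \<in> I" for i using V(2)[OF that] by auto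
  then have "finite (PiE I V)" "PiE I V \<noteq> {}"
    using I V(1) by (auto intro: finite_PiE simp: PiE_eq_empty_iff)
  then obtain x where x: "x \<in> PiE I V"
    and min: "\<And>y. y \<in> PiE I V \<Longrightarrow> dist a (closest_point (?C x) a) \<le> dist a (closest_point (?C y) a)"
    using ex_is_arg_min_if_finite[of "PiE I V" "\<lambda>x. dist a (closest_point (?C x) a)"]
    unfolding is_arg_min_linorder by blast
  have "a \<in> ?C x"
  proof (rule ccontr)
    assume "a \<notin> ?C x"
    define z where "z = closest_point (?C x) a"
    have z: "z \<in> ?C x" "\<forall>y\<in>?C x. dist a z \<le> dist a y"
      using closest_point_exists[OF cl ne] by (auto simp: z_def)
    define u where "u = a - z"
    have "u \<noteq> 0" using z \<open>a \<notin> ?C x\<close> by (auto simp: u_def)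
    have dot: "u \<bullet> (w - z) \<le> 0" if "w \<in> ?C x" for w
      unfolding u_def using any_closest_point_dot[OF convex_convex_cone_hull cl z(1) that z(2)] .
    \<comment> \<open>The test points \<open>z + z\<close> and \<open>0\<close> give the two
      opposite inequalities for \<open>u \<bullet> z\<close>.\<close>
    have "z + z \<in> ?C x" using z by (simp add: convex_cone_hull_add)
    from dot[OF this] dot[OF convex_cone_hull_contains_0] have uz: "u \<bullet> z = 0" by simp
    have ux: "u \<bullet> x i \<le> 0" if "i \<in> I" for i
      using dot[of "x i"] that uz by (simp add: hull_inc inner_diff_right)
    obtain k where k: "k \<in> I" "z \<in> convex_cone hull (x ` (I - {k}))"
      using conic_drop_generator[OF I z(1) \<open>u \<noteq> 0\<close> uz ux] by blast
    obtain v where v: "v \<in> V k" "u \<bullet> v > 0"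
    proof (rule ccontr)
      assume "\<not> thesis"
      then have "V k \<subseteq> {w. u \<bullet> w \<le> 0}" using that by force
      then have "convex hull (V k) \<subseteq> {w. u \<bullet> w \<le> 0}"
        by (intro hull_minimal) (auto simp: convex_halfspace_le)
      then have "u \<bullet> a \<le> 0" using V(2)[OF k(1)] by auto
      moreover have "u \<bullet> a = u \<bullet> u" using uz by (simp add: u_def inner_diff_right)
      ultimately show False using \<open>u \<noteq> 0\<close> inner_gt_zero_iff[of u] by linarith
    qed
    let ?y = "x(k := v)"
    have y: "?y \<in> PiE I V" using x k v by (auto simp: PiE_iff extensional_def)
    have "x ` (I - {k}) \<subseteq> ?y ` I" by auto
    then have zy: "z \<in> ?C ?y" using k(2) hull_mono by blast
    have vy: "v \<in> ?C ?y" using k(1) by (intro hull_inc) force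
    obtain s where s: "s > 0" "dist (z + s *\<^sub>R (z + v - z)) a < dist z a"
      using closer_point_lemma[of a z "z + v"] v by (auto simp: u_def)
    have "z + s *\<^sub>R v \<in> ?C ?y"
      using zy vy s(1) by (simp add: convex_cone_hull_add convex_cone_hull_mul)
    then have "dist a (closest_point (?C ?y) a) \<le> dist a (z + s *\<^sub>R v)"
      by (intro closest_point_le cl)
    also have "\<dots> < dist a z" using s by (simp add: dist_commute)
    finally show False using min[OF y] by (simp add: z_def)
  qed
  with x that show thesis by blast
qed

text \<open>Points \<^term>\<open>p\<close> strictly between \<^term>\<open>q\<close> and \<^term>\<open>v\<close> are handled by the cone version with apex \<^term>\<open>p\<close>.
  Restricting to finite subsets leaves finitely many choices, so the set of points that are covered by some
  choice is closed and contains \<^term>\<open>v\<close> as well.\<close>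

lemma colorful_caratheodory_point:
  fixes X :: "'i \<Rightarrow> 'a::euclidean_space set"
  assumes I: "finite I" "card I = DIM('a)"
    and X: "\<And>i. i \<in> I \<Longrightarrow> v \<in> convex hull (X i)"
  obtains x where "x \<in> Pi I X" "v \<in> convex hull (insert q (x ` I))"
proof -
  have "\<exists>Y. finite Y \<and> Y \<subseteq> X i \<and> v \<in> convex hull Y" if "i \<in> I" for i
    using X[OF that] caratheodory[of "X i"] by auto
  then obtain Y where Y: "\<And>i. i \<in> I \<Longrightarrow> finite (Y i)" "\<And>i. i \<in> I \<Longrightarrow> Y i \<subseteq> X i"
    "\<And>i. i \<in> I \<Longrightarrow> v \<in> convex hull (Y i)" by metis
  let ?H = "\<lambda>x. convex hull (insert q (x ` I))"
  let ?U = "\<Union>x\<in>PiE I Y. ?H x"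
  have ne: "PiE I Y \<noteq> {}" using Y(3) by (fastforce simp: PiE_eq_empty_iff)
  have "closed ?U"
    using I Y(1)
    by (intro closed_UN finite_PiE ballI compact_imp_closed finite_imp_compact_convex_hull) auto
  moreover have "open_segment q v \<subseteq> ?U"
  proof
    fix p assume "p \<in> open_segment q v"
    then obtain t where t: "0 < t" "t < 1" "p = (1 - t) *\<^sub>R q + t *\<^sub>R v"
      by (auto simp: in_segment)
    have "v - p \<in> convex hull ((\<lambda>y. y - p) ` Y i)" if "i \<in> I" for i
      using Y(3)[OF that] convex_hull_translation[of "- p" "Y i"] by auto
    then obtain w where w: "w \<in> PiE I (\<lambda>i. (\<lambda>y. y - p) ` Y i)" "v - p \<in> convex_cone hull (w ` I)"
      using colorful_caratheodory_cone[OF I, of "\<lambda>i. (\<lambda>y. y - p) ` Y i" "v - p"] Y(1) by blast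
    define x where "x = restrict (\<lambda>i. w i + p) I"
    have x: "x \<in> PiE I Y"
    proof -
      have "w i + p \<in> Y i" if "i \<in> I" for i
        using PiE_mem[OF w(1) that] by auto
      then show ?thesis by (simp add: x_def)
    qed
    have "p \<in> ?H x"
    proof (cases "v - p = 0")
      case True
      then have "(1 - t) *\<^sub>R v = (1 - t) *\<^sub>R q" using t(3) by (simp add: algebra_simps)
      then have "p = q" using True t by simp
      then show ?thesis by (simp add: hull_inc)
    next
      case False
      then obtain y c where y: "y \<in> convex hull (w ` I)" "c \<ge> 0" "v - p = c *\<^sub>R y"
        using w(2) unfolding convex_cone_hull_convex_hull by auto
      have "(\<lambda>z. p + z) ` w ` I = x ` I" by (auto simp: x_def image_image add.commute)
      then have "p + y \<in> convex hull (x ` I)"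
        using y(1) convex_hull_translation[of p "w ` I"] by auto
      then have y': "p + y \<in> ?H x" using hull_mono[of "x ` I" "insert q (x ` I)" convex] by auto
      \<comment> \<open>This factor satisfies \<open>p - q = s *\<^sub>R y\<close>, which makes
        \<open>p\<close> a convex combination of \<open>q\<close> and \<open>p + y\<close>.\<close>
      define s where "s = t / (1 - t) * c"
      have s: "s \<ge> 0" using y t by (simp add: s_def)
      have "(1 - t) *\<^sub>R (p - q) = t *\<^sub>R (v - p)"
        unfolding t(3) by (simp add: algebra_simps)
      then have "(1 - t) *\<^sub>R (p - q) = (1 - t) *\<^sub>R (s *\<^sub>R y)"
        using t y(3) by (simp add: s_def)
      then have "p - q = s *\<^sub>R y" using t(2) unfolding scaleR_cancel_left by simp
      then have "(1 + s) *\<^sub>R p = q + s *\<^sub>R (p + y)" by (simp add: algebra_simps)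
      then have "(1 / (1 + s)) *\<^sub>R ((1 + s) *\<^sub>R p) = (1 / (1 + s)) *\<^sub>R (q + s *\<^sub>R (p + y))"
        by simp
      then have "p = (1 / (1 + s)) *\<^sub>R q + (s / (1 + s)) *\<^sub>R (p + y)"
        using s by (simp add: scaleR_right_distrib)
      also have "\<dots> \<in> ?H x"
        using s y' by (intro convexD[OF convex_convex_hull]) (auto simp: hull_inc field_simps)
      finally show ?thesis .
    qed
    then show "p \<in> ?U" using x by blast
  qed
  ultimately have "closure (open_segment q v) \<subseteq> ?U" by (rule closure_minimal[rotated])
  \<comment> \<open>For \<open>q = v\<close> the open segment is empty, but then \<open>v\<close> is
    itself one of the points that generate the hull.\<close>
  moreover have "v \<in> ?U" if "q = v" using ne that by (auto simp: hull_inc)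
  ultimately have "v \<in> ?U" by (cases "q = v") auto
  then obtain x where x: "x \<in> PiE I Y" "v \<in> ?H x" by blast
  show thesis
  proof (rule that)
    show "x \<in> Pi I X" using PiE_mem[OF x(1)] Y(2) by blast
    show "v \<in> ?H x" by fact
  qed
qed

section \<open>Existence of a vertex bound that is uniform in the convex set\<close>

text \<open>In an unbounded \<open>K\<close> the hull of a ball and a very distant point contains a
  long row of disjoint balls of half the radius, whose total volume exceeds that of
  \<open>K\<close>.\<close>

lemma bounded_convex_lmeasurable:
  fixes K :: "'a::euclidean_space set"
  assumes K: "convex K" "K \<in> lmeasurable" "interior K \<noteq> {}"
  shows "bounded K"
proof (rule ccontr)
  assume "\<not> bounded K"
  obtain c r where r: "r > 0" "ball c r \<subseteq> K"
    using K(3) mem_interior by (metis ex_in_conv)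
  let ?v = "measure lebesgue (ball (0::'a) (r/2))"
  have vpos: "?v > 0" using r by (simp add: content_ball_pos)
  obtain N :: nat where N: "real N * ?v > measure lebesgue K"
    using reals_Archimedean3[OF vpos] by blast
  obtain x where x: "x \<in> K" "norm (x - c) > 2 * r * real N + 1"
  proof (rule ccontr)
    assume "\<not> thesis"
    then have "\<forall>x\<in>K. dist c x \<le> 2 * r * real N + 1"
      using that by (force simp: dist_norm norm_minus_commute)
    then show False using \<open>\<not> bounded K\<close> by (auto simp: bounded_def)
  qed
  define L where "L = norm (x - c)"
  have "2 * r * real N \<ge> 0" using r by simp
  then have L: "L > 2 * r * real N + 1" "L > 0" using x by (simp_all only: L_def)
  \<comment> \<open>The centres of the \<open>B j\<close> are spaced \<open>r\<close> apart on the
    segment from \<open>c\<close> to \<open>x\<close>. As \<open>x\<close> is so distant that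
    \<open>t j \<le> 1/2\<close>, the homothety with centre \<open>x\<close> and ratio
    \<open>1 - t j\<close> maps \<open>ball c r\<close> onto a ball that contains
    \<open>B j\<close>.\<close>
  define t where "t j = real j * r / L" for j :: nat
  define B where "B j = ball (c + t j *\<^sub>R (x - c)) (r/2)" for j
  have t: "0 \<le> t j" "t j \<le> 1/2" if "j < N" for j
  proof -
    have "real j * r \<le> real N * r" using that r by (intro mult_right_mono) auto
    then have "2 * (real j * r) \<le> L" using L by (simp add: algebra_simps)
    then show "t j \<le> 1/2" using L by (simp add: t_def field_simps)
    show "0 \<le> t j" using L r by (simp add: t_def)
  qed
  have dist_add_self: "dist c (c + w) = norm w" for w by (simp add: dist_norm)
  have sub: "B j \<subseteq> K" if "j < N" for j
  proof
    fix y assume "y \<in> B j"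
    define w where "w = y - (c + t j *\<^sub>R (x - c))"
    have w: "norm w < r/2" using \<open>y \<in> B j\<close> by (simp add: B_def w_def dist_norm norm_minus_commute)
    have t': "1 - t j \<ge> 1/2" "1 - t j > 0" using t[OF that] by auto
    have "norm w / (1 - t j) < r"
    proof -
      have "norm w < r * (1/2)" using w by simp
      also have "\<dots> \<le> r * (1 - t j)" using t' r by (intro mult_left_mono) auto
      finally show ?thesis using t' by (simp add: field_simps)
    qed
    moreover have "norm (w /\<^sub>R (1 - t j)) = norm w / (1 - t j)"
      using t'(2) by (simp only: norm_scaleR abs_inverse abs_of_pos divide_inverse_commute)
    ultimately have "dist c (c + w /\<^sub>R (1 - t j)) < r" by (simp only: dist_add_self)
    then have "c + w /\<^sub>R (1 - t j) \<in> K" using r(2) by (simp only: mem_ball subset_iff)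
    then have "(1 - t j) *\<^sub>R (c + w /\<^sub>R (1 - t j)) + t j *\<^sub>R x \<in> K"
      using x t[OF that] t' by (intro convexD[OF K(1)]) auto
    also have "(1 - t j) *\<^sub>R (c + w /\<^sub>R (1 - t j)) + t j *\<^sub>R x = y"
    proof -
      have "(1 - t j) *\<^sub>R (w /\<^sub>R (1 - t j)) = w"
        using t'(2) by (simp only: scaleR_scaleR) (simp add: field_simps)
      then show ?thesis by (simp only: scaleR_right_distrib) (simp add: w_def algebra_simps)
    qed
    finally show "y \<in> K" .
  qed
  have disj: "disjnt (B i) (B j)" if "i \<noteq> j" for i j
  proof -
    have "dist (c + t i *\<^sub>R (x - c)) (c + t j *\<^sub>R (x - c)) = \<bar>t i - t j\<bar> * L"
      by (simp add: dist_norm L_def flip: scaleR_left_diff_distrib)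
    also have "\<dots> = \<bar>(t i - t j) * L\<bar>" using L by (simp add: abs_mult)
    also have "(t i - t j) * L = (real i - real j) * r"
      using L by (simp add: t_def field_simps)
    also have "\<bar>\<dots>\<bar> = \<bar>real i - real j\<bar> * r" using r by (simp add: abs_mult)
    also have "\<dots> \<ge> 1 * r" using that r by (intro mult_right_mono) auto
    finally show ?thesis unfolding B_def disjnt_def by (intro disjoint_ballI) simp
  qed
  have "real N * ?v = (\<Sum>j<N. measure lebesgue (B j))"
  proof -
    have "measure lebesgue (B j) = ?v" for j
    proof -
      have "B j = (+) (c + t j *\<^sub>R (x - c)) ` ball 0 (r/2)"
        unfolding B_def ball_translation[symmetric] by simp
      then show ?thesis by (simp only: measure_translation)
    qed
    then show ?thesis by simp
  qed
  also have "\<dots> = measure lebesgue (\<Union>j<N. B j)"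
    using disj by (subst measure_UNION') (auto simp: B_def pairwise_def)
  also have "\<dots> \<le> measure lebesgue K"
    using sub K by (intro measure_mono_fmeasurable) (auto simp: B_def)
  finally show False using N by simp
qed

lemma small_hull_neighbourhood:
  fixes x :: "'a::euclidean_space"
  assumes "\<eta> > 0"
  obtains S where "finite S" "S \<subseteq> ball x \<eta>" "x \<in> interior (convex hull S)"
proof -
  \<comment> \<open>With this half side length, the l1 bound on the distance from \<open>x\<close>
    within the cube is \<open>\<eta> / 2\<close>.\<close>
  define d where "d = \<eta> / (2 * real DIM('a))"
  have d: "d > 0" using assms by (simp add: d_def)
  let ?o = "\<Sum>i\<in>Basis. d *\<^sub>R i :: 'a"
  obtain S where S: "finite S" "cbox (x - ?o) (x + ?o) = convex hull S"
    using cube_convex_hull[OF d] by blast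
  have "S \<subseteq> ball x \<eta>"
  proof
    fix y assume "y \<in> S"
    then have "y \<in> cbox (x - ?o) (x + ?o)" using S(2) by (simp add: hull_inc)
    then have "\<bar>(y - x) \<bullet> i\<bar> \<le> d" if "i \<in> Basis" for i
      using that by (auto simp: mem_box inner_simps abs_le_iff)
    then have "(\<Sum>i\<in>Basis. \<bar>(y - x) \<bullet> i\<bar>) \<le> real DIM('a) * d"
      using sum_bounded_above[of Basis "\<lambda>i. \<bar>(y - x) \<bullet> i\<bar>" d] by simp
    then have "norm (y - x) \<le> real DIM('a) * d" using norm_le_l1 order_trans by blast
    also have "\<dots> < \<eta>" using assms by (simp add: d_def)
    finally show "y \<in> ball x \<eta>" by (simp add: dist_norm norm_minus_commute)
  qed
  moreover have "x \<in> box (x - ?o) (x + ?o)"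
    using d by (simp add: mem_box inner_simps)
  then have "x \<in> interior (convex hull S)"
    by (simp flip: S(2) add: interior_cbox)
  ultimately show thesis using that S(1) by blast
qed

text \<open>Each \<open>x\<close> is interior to the hull of a finite set within
  \<open>\<eta>/2\<close> of it, and finitely many of these interiors cover \<open>Q\<close>. If
  \<open>y\<close> is in the hull belonging to \<open>x\<close>, then \<open>y\<close> is within
  \<open>\<eta>/2\<close> of \<open>x\<close>, so the whole finite set is within
  \<open>\<eta>\<close> of \<open>y\<close>.\<close>

lemma finite_hull_net:
  fixes Q :: "'a::euclidean_space set"
  assumes "compact Q" "\<eta> > 0"
  obtains G where "finite G" "\<And>y. y \<in> Q \<Longrightarrow> y \<in> convex hull (G \<inter> ball y \<eta>)"
proof -
  have "\<exists>S. finite S \<and> S \<subseteq> ball x (\<eta>/2) \<and> x \<in> interior (convex hull S)" for x :: 'a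
    using small_hull_neighbourhood[of "\<eta>/2" x] assms(2) by force
  then obtain S where S: "\<And>x::'a. finite (S x)" "\<And>x. S x \<subseteq> ball x (\<eta>/2)"
    "\<And>x. x \<in> interior (convex hull (S x))" by metis
  obtain C where C: "C \<subseteq> Q" "finite C" "Q \<subseteq> (\<Union>x\<in>C. interior (convex hull (S x)))"
    using compactE_image[OF assms(1), of Q "\<lambda>x. interior (convex hull (S x))"] S(3)
    by (metis (no_types, lifting) UN_I open_interior subsetI)
  show thesis
  proof
    show "finite (\<Union>x\<in>C. S x)" using C S by auto
    fix y assume "y \<in> Q"
    then obtain x where x: "x \<in> C" "y \<in> convex hull (S x)"
      using C interior_subset by blast
    have "convex hull (S x) \<subseteq> ball x (\<eta>/2)" using S(2) by (intro hull_minimal) auto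
    then have "dist x y < \<eta>/2" using x by auto
    have "S x \<subseteq> ball y \<eta>"
    proof
      fix z assume "z \<in> S x"
      then have "dist x z < \<eta>/2" using S(2)[of x] by (auto simp: subset_iff)
      with \<open>dist x y < \<eta>/2\<close> show "z \<in> ball y \<eta>"
        using dist_triangle[of y z x] by (simp add: dist_commute)
    qed
    then have "S x \<subseteq> (\<Union>x\<in>C. S x) \<inter> ball y \<eta>" using x by auto
    then show "y \<in> convex hull ((\<Union>x\<in>C. S x) \<inter> ball y \<eta>)" using x(2) hull_mono by blast
  qed
qed

text \<open>Every shrunken point is the centre of a ball of radius \<open>\<delta> * r\<close>
  inside \<open>K\<close>, so a net of that mesh has it in the hull of net points from
  \<open>K\<close>. Both \<open>c\<close> and \<open>r\<close> come from the simplex, hence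
  \<open>G\<close> is chosen before \<open>K\<close>. Only the interior of the simplex is assumed to
  lie in \<open>K\<close>, since \<open>K\<close> may fail to be closed.\<close>

lemma normalized_convex_net:
  assumes "0 < \<delta>" "\<delta> < 1"
  obtains G :: "'a::euclidean_space set" and c where "finite G"
    "\<forall>K. convex K \<and> interior (convex hull (insert 0 Basis)) \<subseteq> K \<and> K \<subseteq> cbox (- One) One \<longrightarrow>
      (\<lambda>y. (1 - \<delta>) *\<^sub>R y + \<delta> *\<^sub>R c) ` K \<subseteq> convex hull (G \<inter> K)"
proof -
  obtain c :: 'a where "c \<in> interior (convex hull (insert 0 Basis))"
    using interior_std_simplex_nonempty by blast
  then obtain r where r: "r > 0" "ball c r \<subseteq> interior (convex hull (insert 0 Basis))"
    using open_contains_ball open_interior by blast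
  obtain G :: "'a set" where G: "finite G" "\<And>y. y \<in> cbox (- One) One \<Longrightarrow> y \<in> convex hull (G \<inter> ball y (\<delta> * r))"
    using finite_hull_net[of "cbox (- One) One :: 'a set" "\<delta> * r"] assms r by (metis compact_cbox mult_pos_pos)
  show thesis
  proof
    show "finite G" by fact
    show "\<forall>K. convex K \<and> interior (convex hull (insert 0 Basis)) \<subseteq> K \<and> K \<subseteq> cbox (- One) One \<longrightarrow>
      (\<lambda>y. (1 - \<delta>) *\<^sub>R y + \<delta> *\<^sub>R c) ` K \<subseteq> convex hull (G \<inter> K)"
    proof (intro allI impI; elim conjE)
      fix K :: "'a set"
      assume K: "convex K" "interior (convex hull (insert 0 Basis)) \<subseteq> K" "K \<subseteq> cbox (- One) One"
      show "(\<lambda>y. (1 - \<delta>) *\<^sub>R y + \<delta> *\<^sub>R c) ` K \<subseteq> convex hull (G \<inter> K)"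
      proof clarify
        fix y assume y: "y \<in> K"
        let ?x = "(1 - \<delta>) *\<^sub>R y + \<delta> *\<^sub>R c"
        have ball: "ball ?x (\<delta> * r) \<subseteq> K"
        proof
          fix w assume "w \<in> ball ?x (\<delta> * r)"
          then have "norm (w - ?x) < \<delta> * r" by (simp add: dist_norm norm_minus_commute)
          then have "norm ((w - ?x) /\<^sub>R \<delta>) < r"
            using assms pos_divide_less_eq[of \<delta> _ r]
            by (simp only: norm_scaleR abs_inverse abs_of_pos inverse_eq_divide) (simp add: mult.commute)
          then have "c + (w - ?x) /\<^sub>R \<delta> \<in> K"
            using r K by (intro subsetD[OF K(2)] subsetD[OF r(2)]) (simp add: dist_norm)
          \<comment> \<open>The point \<open>w\<close> is a convex combination of \<open>y\<close>
            and a point of \<open>ball c r\<close>, both in \<open>K\<close>.\<close>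
          then have "(1 - \<delta>) *\<^sub>R y + \<delta> *\<^sub>R (c + (w - ?x) /\<^sub>R \<delta>) \<in> K"
            using y assms by (intro convexD[OF K(1)]) auto
          also have "(1 - \<delta>) *\<^sub>R y + \<delta> *\<^sub>R (c + (w - ?x) /\<^sub>R \<delta>) = w"
            using assms by (simp add: scaleR_right_distrib)
          finally show "w \<in> K" .
        qed
        then have "?x \<in> K" using assms r by (intro subsetD[OF ball]) simp
        then have "?x \<in> convex hull (G \<inter> ball ?x (\<delta> * r))" using K G by blast
        then show "?x \<in> convex hull (G \<inter> K)" using ball hull_mono[of "G \<inter> ball ?x (\<delta> * r)" "G \<inter> K" convex] by blast
      qed
    qed
  qed
qed

text \<open>Provides the compact domain on which \<open>affine_normalization\<close> maximises the
  determinant.\<close>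

lemma compact_Collect_rows:
  fixes C :: "(real ^ 'n) set"
  assumes "compact C"
  shows "compact {A :: real ^ 'n ^ 'm. \<forall>i. A $ i \<in> C}"
proof -
  obtain b where b: "\<And>x. x \<in> C \<Longrightarrow> norm x \<le> b"
    using compact_imp_bounded[OF assms] by (auto simp: bounded_iff)
  have "norm A \<le> (\<Sum>i\<in>(UNIV::'m set). b)" if "\<forall>i. A $ i \<in> C" for A :: "real ^ 'n ^ 'm"
  proof -
    have "norm A \<le> (\<Sum>i\<in>UNIV. norm (A $ i))" by (simp add: norm_vec_def L2_set_le_sum)
    also have "\<dots> \<le> (\<Sum>i\<in>(UNIV::'m set). b)" using that b by (intro sum_mono) auto
    finally show ?thesis .
  qed
  then have "bounded {A :: real ^ 'n ^ 'm. \<forall>i. A $ i \<in> C}" by (auto simp: bounded_iff)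
  moreover have "closed {A :: real ^ 'n ^ 'm. A $ i \<in> C}" for i
  proof -
    have "closed ((\<lambda>A :: real ^ 'n ^ 'm. A $ i) -` C)"
      by (intro continuous_closed_vimage compact_imp_closed[OF assms] continuous_intros)
    then show ?thesis by (simp add: vimage_def)
  qed
  then have "closed {A :: real ^ 'n ^ 'm. \<forall>i. A $ i \<in> C}"
    by (intro closed_Collect_all)
  ultimately show ?thesis by (simp add: compact_eq_bounded_closed)
qed

lemma continuous_on_det: "continuous_on S (det :: real ^ 'n ^ 'n \<Rightarrow> real)"
  unfolding det_def by (intro continuous_intros)

text \<open>With an interior point \<^term>\<open>b\<close> as origin, the columns of \<^term>\<open>f\<close> are points of the closure of the body
  chosen to maximise the absolute value of the determinant; Cramer's rule then bounds all coordinates by 1.\<close>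

lemma affine_normalization:
  fixes K :: "(real ^ 'd) set"
  assumes K: "convex K" "bounded K" "interior K \<noteq> {}"
  obtains b and f :: "real ^ 'd \<Rightarrow> real ^ 'd" where "linear f" "inj f"
    "interior (convex hull (insert 0 Basis)) \<subseteq> {y. b + f y \<in> K}"
    "{y. b + f y \<in> K} \<subseteq> cbox (- One) One"
proof -
  obtain b r where r: "r > 0" "ball b r \<subseteq> K"
    using K(3) mem_interior by (metis ex_in_conv)
  \<comment> \<open>Passing to the closure gives compactness, so that the maximal determinant is
    attained.\<close>
  define C where "C = (\<lambda>x. - b + x) ` closure K"
  have C: "compact C" unfolding C_def using K(2) by (intro compact_translation) simp
  have memC: "y \<in> C \<longleftrightarrow> b + y \<in> closure K" for y by (force simp: C_def)
  have "convex C" using K(1) by (simp add: C_def convex_translation)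
  let ?D = "{A :: real ^ 'd ^ 'd. \<forall>i. A $ i \<in> C}"
  \<comment> \<open>This admissible matrix has positive determinant, which forces the maximal one to
    be nonzero.\<close>
  have D: "mat (r/2) \<in> ?D"
  proof clarify
    fix i
    have "(mat (r/2) :: real ^ 'd ^ 'd) $ i = (r/2) *\<^sub>R axis i 1"
      by (auto simp: vec_eq_iff mat_def axis_def)
    then have "b + (mat (r/2) :: real ^ 'd ^ 'd) $ i \<in> ball b r"
      using r by (simp add: dist_norm)
    then show "(mat (r/2) :: real ^ 'd ^ 'd) $ i \<in> C"
      using r closure_subset unfolding memC by blast
  qed
  have "continuous_on ?D (\<lambda>A. \<bar>det A\<bar>)"
    by (intro continuous_intros continuous_on_det)
  then obtain A where A: "A \<in> ?D" and max: "\<And>B. B \<in> ?D \<Longrightarrow> \<bar>det B\<bar> \<le> \<bar>det A\<bar>"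
    using continuous_attains_sup[OF compact_Collect_rows[OF C], of "\<lambda>A. \<bar>det A\<bar>"] D by blast
  have "det (mat (r/2) :: real ^ 'd ^ 'd) = (r/2) ^ CARD('d)"
    by (subst det_diagonal) (auto simp: mat_def)
  moreover have "(r/2) ^ CARD('d) > 0" using r by simp
  ultimately have "det A \<noteq> 0" using max[OF D] by auto
  define f where "f y = (\<Sum>i\<in>UNIV. y $ i *s row i A)" for y
  have lin: "linear f"
    by (rule linearI) (auto simp: f_def vec_eq_iff sum.distrib sum_distrib_left algebra_simps)
  have cramer: "det (\<chi> i. if i = k then f y else row i A) = y $ k * det A" for k y
    unfolding f_def by (rule cramer_lemma_transpose)
  have "inj f"
    unfolding linear_injective_0[OF lin]
  proof (intro allI impI)
    fix y assume "f y = 0"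
    have "y $ k = 0" for k
    proof -
      have "det (\<chi> i. if i = k then f y else row i A) = 0"
        using \<open>f y = 0\<close> by (intro det_zero_row(1)[of k]) (simp add: row_def vec_eq_iff)
      then show ?thesis using cramer[of k y] \<open>det A \<noteq> 0\<close> by simp
    qed
    then show "y = 0" by (simp add: vec_eq_iff)
  qed
  have rowA: "row i A \<in> C" for i using A by (simp add: row_def)
  have cube: "{y. b + f y \<in> K} \<subseteq> cbox (- One) One"
  proof clarify
    fix y assume "b + f y \<in> K"
    then have fy: "f y \<in> C" using closure_subset by (auto simp: memC)
    have "\<bar>y $ k\<bar> \<le> 1" for k
    proof -
      have "(\<chi> i. if i = k then f y else row i A) \<in> ?D" using fy rowA by simp
      from max[OF this] have "\<bar>y $ k\<bar> * \<bar>det A\<bar> \<le> 1 * \<bar>det A\<bar>" by (simp add: cramer abs_mult)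
      then show ?thesis using \<open>det A \<noteq> 0\<close> by simp
    qed
    then have "- 1 \<le> y \<bullet> i \<and> y \<bullet> i \<le> 1" if "i \<in> Basis" for i
      using that by (fastforce simp: Basis_vec_def inner_axis abs_le_iff)
    then show "y \<in> cbox (- One) One"
      by (simp add: mem_box)
  qed
  have simplex: "interior (convex hull (insert 0 Basis)) \<subseteq> {y. b + f y \<in> K}"
  proof -
    have "f ` insert 0 Basis \<subseteq> C"
    proof -
      have "f 0 = 0" using lin by (rule linear_0)
      moreover have "0 \<in> C" using r centre_in_ball closure_subset by (fastforce simp: memC)
      moreover have "f (axis i 1) = row i A" for i
        by (simp add: f_def axis_def if_distrib[of "\<lambda>c. c *s _"] vec_eq_iff cong: if_cong)
      ultimately show ?thesis using rowA by (auto simp: Basis_vec_def)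
    qed
    then have "convex hull (f ` insert 0 Basis) \<subseteq> C" using \<open>convex C\<close> by (rule hull_minimal)
    then have "f ` (convex hull (insert 0 Basis)) \<subseteq> C" using convex_hull_linear_image[OF lin] by metis
    then have "interior (f ` (convex hull (insert 0 Basis))) \<subseteq> interior C" by (rule interior_mono)
    then have "f ` interior (convex hull (insert 0 Basis)) \<subseteq> interior C"
      by (simp add: interior_injective_linear_image[OF lin \<open>inj f\<close>])
    \<comment> \<open>A convex set and its closure have the same interior; this leads from the
      closure back to \<open>K\<close>.\<close>
    moreover have "interior C = (\<lambda>x. - b + x) ` interior K"
      unfolding C_def interior_translation convex_interior_closure[OF K(1)] ..
    ultimately show ?thesis using interior_subset by fastforce
  qed
  show thesis using that lin \<open>inj f\<close> simplex cube by blast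
qed

text \<open>The number of points in the fixed net serves for every \<open>K\<close>. The inclusion
  of the shrunken copy is carried back to \<open>K\<close> by the normalising map, so volumes are
  compared only in the original coordinates, where the shrinking contributes the factor
  \<open>(1 - \<delta>) ^ CARD('d)\<close>.\<close>

lemma uniform_polytope_approximation:
  assumes "\<epsilon> > 0"
  shows "\<exists>n. \<forall>K :: (real ^ 'd) set. convex K \<and> K \<in> lmeasurable \<and> vol K > 0 \<longrightarrow>
      (\<exists>P. polytope P \<and> P \<subseteq> K \<and> card {v. v extreme_point_of P} \<le> n \<and>
           vol P \<ge> (1 - \<epsilon>) * vol K)"
proof -
  \<comment> \<open>The second term gives
    \<open>1 - \<epsilon> \<le> (1 - \<delta>) ^ CARD('d)\<close> by Bernoulli's inequality; the
    first keeps \<open>\<delta>\<close> below 1 for large \<open>\<epsilon>\<close>.\<close>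
  define \<delta> where "\<delta> = min (1/2) (\<epsilon> / real CARD('d))"
  have \<delta>: "0 < \<delta>" "\<delta> < 1" using assms by (auto simp: \<delta>_def)
  have "1 - \<epsilon> \<le> 1 + real CARD('d) * (- \<delta>)"
  proof -
    have "real CARD('d) * \<delta> \<le> real CARD('d) * (\<epsilon> / real CARD('d))"
      by (intro mult_left_mono) (auto simp: \<delta>_def)
    then show ?thesis by simp
  qed
  also have "\<dots> \<le> (1 + (- \<delta>)) ^ CARD('d)" using \<delta> by (intro Bernoulli_inequality) auto
  finally have bern: "1 - \<epsilon> \<le> (1 - \<delta>) ^ CARD('d)" by simp
  obtain G :: "(real ^ 'd) set" and c where G: "finite G"
    "\<forall>K. convex K \<and> interior (convex hull (insert 0 Basis)) \<subseteq> K \<and> K \<subseteq> cbox (- One) One \<longrightarrow>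
      (\<lambda>y. (1 - \<delta>) *\<^sub>R y + \<delta> *\<^sub>R c) ` K \<subseteq> convex hull (G \<inter> K)"
    by (rule normalized_convex_net[OF \<delta>])
  show ?thesis
  proof (intro exI[of _ "card G"] allI impI; elim conjE)
    fix K :: "(real ^ 'd) set" assume K: "convex K" "K \<in> lmeasurable" "vol K > 0"
    then have "interior K \<noteq> {}"
      using negligible_convex_interior[OF K(1)] negligible_imp_measure0 by force
    then have "bounded K" using bounded_convex_lmeasurable K by blast
    then obtain b and f :: "real ^ 'd \<Rightarrow> real ^ 'd" where f: "linear f" "inj f"
      "interior (convex hull (insert 0 Basis)) \<subseteq> {y. b + f y \<in> K}"
      "{y. b + f y \<in> K} \<subseteq> cbox (- One) One"
      by (rule affine_normalization[OF K(1) _ \<open>interior K \<noteq> {}\<close>])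
    let ?g = "\<lambda>y. b + f y"
    let ?K = "{y. ?g y \<in> K}"
    have surj: "surj f" using f linear_injective_imp_surjective by blast
    have "convex ?K"
    proof (rule convexI)
      fix x y and s t :: real assume *: "x \<in> ?K" "y \<in> ?K" "0 \<le> s" "0 \<le> t" "s + t = 1"
      then have "s *\<^sub>R ?g x + t *\<^sub>R ?g y \<in> K" by (intro convexD[OF K(1)]) auto
      also have "s *\<^sub>R ?g x + t *\<^sub>R ?g y = (s + t) *\<^sub>R b + f (s *\<^sub>R x + t *\<^sub>R y)"
        using f(1) by (simp add: linear_add linear_scale algebra_simps)
      finally show "s *\<^sub>R x + t *\<^sub>R y \<in> ?K" using * by simp
    qed
    with G(2) f(3,4) have sub: "(\<lambda>y. (1 - \<delta>) *\<^sub>R y + \<delta> *\<^sub>R c) ` ?K \<subseteq> convex hull (G \<inter> ?K)"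
      by blast
    define T where "T = ?g ` (G \<inter> ?K)"
    have T: "finite T" "T \<subseteq> K" "card T \<le> card G"
      using G(1) card_image_le[of "G \<inter> ?K" ?g] card_mono[of G "G \<inter> ?K"] by (auto simp: T_def)
    have hullT: "convex hull T = ?g ` (convex hull (G \<inter> ?K))"
    proof -
      have "T = (+) b ` f ` (G \<inter> ?K)" by (simp add: T_def image_image)
      then have "convex hull T = (+) b ` f ` (convex hull (G \<inter> ?K))"
        by (simp only: convex_hull_translation convex_hull_linear_image[OF f(1)])
      then show ?thesis by (simp add: image_image)
    qed
    have shrink: "(\<lambda>y. (1 - \<delta>) *\<^sub>R y + \<delta> *\<^sub>R ?g c) ` K \<subseteq> convex hull T"
    proof clarify
      fix x assume "x \<in> K"
      obtain y where y: "x = ?g y" using surj by (metis add.commute diff_add_cancel surjD)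
      then have "(1 - \<delta>) *\<^sub>R y + \<delta> *\<^sub>R c \<in> convex hull (G \<inter> ?K)" using sub \<open>x \<in> K\<close> by blast
      then have "?g ((1 - \<delta>) *\<^sub>R y + \<delta> *\<^sub>R c) \<in> convex hull T" by (simp add: hullT)
      also have "?g ((1 - \<delta>) *\<^sub>R y + \<delta> *\<^sub>R c) = (1 - \<delta>) *\<^sub>R x + \<delta> *\<^sub>R ?g c"
        using f(1) by (simp add: y linear_add linear_diff linear_scale algebra_simps)
      finally show "(1 - \<delta>) *\<^sub>R x + \<delta> *\<^sub>R ?g c \<in> convex hull T" .
    qed
    show "\<exists>P. polytope P \<and> P \<subseteq> K \<and> card {v. v extreme_point_of P} \<le> card G \<and> vol P \<ge> (1 - \<epsilon>) * vol K"
    proof (intro exI[of _ "convex hull T"] conjI)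
      show "polytope (convex hull T)" using T by (simp add: polytope_convex_hull)
      show "convex hull T \<subseteq> K" using T K by (simp add: hull_minimal)
      show "card {v. v extreme_point_of convex hull T} \<le> card G"
        using card_mono[OF T(1) extreme_points_of_convex_hull] T(3) by linarith
      have "(1 - \<epsilon>) * vol K \<le> (1 - \<delta>) ^ CARD('d) * vol K" using bern by (simp add: mult_right_mono)
      also have "\<dots> = vol ((\<lambda>y. (1 - \<delta>) *\<^sub>R y + \<delta> *\<^sub>R ?g c) ` K)"
        using \<delta> by (subst measure_lebesgue_affine) simp
      also have "\<dots> \<le> vol (convex hull T)"
      proof (rule measure_mono_fmeasurable[OF shrink])
        show "convex hull T \<in> lmeasurable"
          using T by (simp add: lmeasurable_compact finite_imp_compact_convex_hull)
        have "convex ((\<lambda>y. (1 - \<delta>) *\<^sub>R y + \<delta> *\<^sub>R ?g c) ` K)"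
          using K(1) convex_affinity[of K "\<delta> *\<^sub>R ?g c" "1 - \<delta>"] by (simp add: add.commute)
        moreover have "bounded ((\<lambda>y. (1 - \<delta>) *\<^sub>R y + \<delta> *\<^sub>R ?g c) ` K)"
          using T shrink by (meson bounded_subset compact_imp_bounded finite_imp_compact_convex_hull)
        ultimately show "(\<lambda>y. (1 - \<delta>) *\<^sub>R y + \<delta> *\<^sub>R ?g c) ` K \<in> sets lebesgue"
          by (simp add: measurable_convex fmeasurableD)
      qed
      finally show "vol (convex hull T) \<ge> (1 - \<epsilon>) * vol K" .
    qed
  qed
qed

text \<open>The uniform bound shows that the set under \<open>LEAST\<close> is nonempty, so its
  least element has the defining property.\<close>

lemma vertex_bound_approximation:
  fixes K :: "(real ^ 'd) set"
  assumes "\<epsilon> > 0" "convex K" "K \<in> lmeasurable" "vol K > 0"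
  shows "\<exists>P. polytope P \<and> P \<subseteq> K \<and> card {v. v extreme_point_of P} \<le> vertex_bound TYPE('d) \<epsilon> \<and>
           vol P \<ge> (1 - \<epsilon>) * vol K"
  using LeastI_ex[OF uniform_polytope_approximation[where 'd='d, OF assms(1)], THEN spec, THEN mp, of K]
    assms(2-4)
  unfolding vertex_bound_def by simp

section \<open>Colourful selections whose hull covers a polytope\<close>

text \<open>A generator outside the hull of the others would be an extreme point, and an extreme
  point is never interior.\<close>

lemma convex_hull_insert_interior:
  fixes S :: "'a::euclidean_space set"
  assumes "finite S" "q \<in> interior (convex hull (insert q S))"
  shows "convex hull (insert q S) = convex hull S"
proof -
  have "q \<in> convex hull S"
    using extreme_point_of_convex_hull_insert[OF assms(1), of q] extreme_point_not_in_interior[of q "convex hull (insert q S)"] assms(2)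
    by blast
  then show ?thesis by (rule hull_redundant)
qed

text \<open>Padding with \<open>q\<close> gives every block of colours a target point, even if the
  polytope has fewer than \<open>n\<close> vertices.\<close>

lemma finite_set_as_sequence:
  assumes "finite E" "card E \<le> n" "q \<in> P" "E \<subseteq> P"
  obtains v :: "nat \<Rightarrow> 'a" where "E \<subseteq> v ` {..<n}" "range v \<subseteq> P"
proof -
  obtain h where h: "bij_betw h {0..<card E} E" using ex_bij_betw_nat_finite[OF assms(1)] by blast
  let ?v = "\<lambda>k. if k < card E then h k else q"
  show thesis
  proof
    show "E \<subseteq> ?v ` {..<n}"
    proof
      fix e assume "e \<in> E"
      then have "e \<in> h ` {0..<card E}" using h by (simp add: bij_betw_def)
      then obtain k where "k < card E" "e = h k" by auto
      then show "e \<in> ?v ` {..<n}" using assms(2) by (intro image_eqI[of _ _ k]) auto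
    qed
    show "range ?v \<subseteq> P" using h assms by (auto simp: bij_betw_def)
  qed
qed

lemma colorful_selection_covering_polytope:
  fixes X :: "nat \<Rightarrow> 'a::euclidean_space set"
  assumes P: "polytope P" "interior P \<noteq> {}" "card {v. v extreme_point_of P} \<le> n"
    and X: "\<And>i. i \<in> {1..DIM('a) * n} \<Longrightarrow> P \<subseteq> convex hull (X i)"
  obtains x where "\<And>i. i \<in> {1..DIM('a) * n} \<Longrightarrow> x i \<in> X i"
    "P \<subseteq> convex hull (x ` {1..DIM('a) * n})"
proof -
  let ?d = "DIM('a)" and ?I = "{1..DIM('a) * n}" and ?E = "{v. v extreme_point_of P}"
  obtain q where q: "q \<in> interior P" using P by auto
  have "finite ?E" using P(1) by (rule finite_polyhedron_extreme_points[OF polytope_imp_polyhedron])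
  then obtain v :: "nat \<Rightarrow> 'a" where v: "?E \<subseteq> v ` {..<n}" "range v \<subseteq> P"
    using finite_set_as_sequence[of ?E n q P] P(3) q interior_subset extreme_point_of_def by blast
  \<comment> \<open>Block \<open>j\<close> holds the \<open>?d\<close> colours assigned to
    \<open>v j\<close>. Colours start at 1 and blocks at 0, so colour \<open>i\<close> is in block
    \<open>(i - 1) div ?d\<close>.\<close>
  define J where "J j = {j * ?d + 1..j * ?d + ?d}" for j
  have J: "finite (J j)" "card (J j) = ?d" for j by (auto simp: J_def)
  have JI: "J j \<subseteq> ?I" if "j < n" for j
  proof -
    have "Suc j * ?d \<le> n * ?d" using that by (intro mult_right_mono) auto
    then show ?thesis by (auto simp: J_def mult.commute)
  qed
  have block: "(i - 1) div ?d = j" if "i \<in> J j" for i j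
    using that by (intro div_nat_eqI) (auto simp: J_def mult.commute)
  have inJ: "i \<in> J ((i - 1) div ?d)" "(i - 1) div ?d < n" if "i \<in> ?I" for i
  proof -
    have "i \<ge> 1" using that by simp
    moreover have "(i - 1) div ?d * ?d \<le> i - 1" by (rule div_times_less_eq_dividend)
    moreover have "i - 1 < (i - 1) div ?d * ?d + ?d"
      using dividend_less_div_times[OF DIM_positive] by (simp add: add.commute)
    ultimately show "i \<in> J ((i - 1) div ?d)"
      unfolding J_def atLeastAtMost_iff by linarith
    have "i - 1 < n * ?d" using that by (auto simp: mult.commute)
    then show "(i - 1) div ?d < n" by (rule less_mult_imp_div_less)
  qed
  have "\<exists>y. (\<forall>i\<in>J j. y i \<in> X i) \<and> v j \<in> convex hull (insert q (y ` J j))" if "j < n" for j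
  proof -
    have "v j \<in> convex hull (X i)" if "i \<in> J j" for i
      using X JI[OF \<open>j < n\<close>] that v(2) by blast
    then obtain y where "y \<in> Pi (J j) X" "v j \<in> convex hull (insert q (y ` J j))"
      by (rule colorful_caratheodory_point[OF J])
    then show ?thesis by blast
  qed
  then obtain y where y: "\<And>j i. j < n \<Longrightarrow> i \<in> J j \<Longrightarrow> y j i \<in> X i"
    "\<And>j. j < n \<Longrightarrow> v j \<in> convex hull (insert q (y j ` J j))" by metis
  \<comment> \<open>The blocks are disjoint, so the separate selections combine into one.\<close>
  define x where "x i = y ((i - 1) div ?d) i" for i
  have x: "x i \<in> X i" if "i \<in> ?I" for i using y(1) inJ[OF that] by (simp add: x_def)
  have "?E \<subseteq> convex hull (insert q (x ` ?I))"
  proof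
    fix e assume "e \<in> ?E"
    then obtain j where j: "j < n" "e = v j" using v(1) by auto
    have "y j ` J j = x ` J j" using block by (auto simp: x_def intro!: image_cong)
    then have "insert q (y j ` J j) \<subseteq> insert q (x ` ?I)" using JI[OF j(1)] by auto
    then show "e \<in> convex hull (insert q (x ` ?I))" using y(2)[OF j(1)] j(2) hull_mono by blast
  qed
  then have "convex hull ?E \<subseteq> convex hull (insert q (x ` ?I))" by (simp add: hull_minimal)
  then have sub: "P \<subseteq> convex hull (insert q (x ` ?I))"
    using Krein_Milman_Minkowski[of P] P(1) by (simp add: polytope_imp_compact polytope_imp_convex)
  then have "q \<in> interior (convex hull (insert q (x ` ?I)))" using q interior_mono by blast
  then have "P \<subseteq> convex hull (x ` ?I)" using sub convex_hull_insert_interior[of "x ` ?I" q] by simp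
  with x that show thesis by blast
qed

lemma colorful_selection_large_volume:
  fixes X :: "nat \<Rightarrow> (real ^ 'd) set"
  assumes "\<epsilon> > 0" and m: "m = CARD('d) * vertex_bound TYPE('d) \<epsilon>"
    and K: "convex K" "vol K = 1" "K \<subseteq> (\<Inter>i\<in>{1..m}. convex hull (X i))"
  shows "\<exists>x. (\<forall>i\<in>{1..m}. x i \<in> X i) \<and> vol (convex hull (x ` {1..m})) \<ge> 1 - \<epsilon>"
proof -
  \<comment> \<open>\<open>measure\<close> is 0 on nonmeasurable sets and on sets of infinite
    measure, so the value 1 excludes both.\<close>
  have "K \<in> sets lebesgue" using K(2) measure_notin_sets by force
  moreover have "emeasure lebesgue K \<noteq> \<infinity>" using K(2) by (auto simp: measure_def)
  ultimately have "K \<in> lmeasurable" by (simp add: fmeasurableI less_top)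
  then obtain P where P: "polytope P" "P \<subseteq> K" "card {v. v extreme_point_of P} \<le> vertex_bound TYPE('d) \<epsilon>"
    "vol P \<ge> 1 - \<epsilon>"
    using vertex_bound_approximation[OF assms(1) K(1)] K(2) by auto
  show ?thesis
  proof (cases "interior P = {}")
    case False
    have "P \<subseteq> convex hull (X i)" if "i \<in> {1..DIM(real ^ 'd) * vertex_bound TYPE('d) \<epsilon>}" for i
      using P(2) K(3) that m by auto
    then obtain x where x: "\<And>i. i \<in> {1..m} \<Longrightarrow> x i \<in> X i" "P \<subseteq> convex hull (x ` {1..m})"
      using colorful_selection_covering_polytope[OF P(1) False P(3), of X] m by auto
    have "vol P \<le> vol (convex hull (x ` {1..m}))"
      using x(2) P(1)
      by (intro measure_mono_fmeasurable)
        (auto simp: lmeasurable_compact finite_imp_compact_convex_hull polytope_imp_compact fmeasurableD)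
    then show ?thesis using x(1) P(4) by (intro exI[of _ x]) auto
  next
    \<comment> \<open>A flat \<open>P\<close> has volume 0, so \<open>1 - \<epsilon> \<le> 0\<close>
      and any selection will do; the \<open>X i\<close> are nonempty because \<open>K\<close>
      is.\<close>
    case True
    then have "vol P = 0"
      using P(1) negligible_convex_interior negligible_imp_measure0 polytope_imp_convex by blast
    have "K \<noteq> {}" using K(2) by auto
    then have "convex hull (X i) \<noteq> {}" if "i \<in> {1..m}" for i
      using K(3) that by blast
    then have "\<forall>i\<in>{1..m}. (SOME y. y \<in> X i) \<in> X i" by (auto simp: some_in_eq)
    moreover have "1 - \<epsilon> \<le> vol S" for S :: "(real ^ 'd) set"
      using \<open>vol P = 0\<close> P(4) measure_nonneg[of lebesgue S] by linarith
    ultimately show ?thesis by (intro exI[of _ "\<lambda>i. SOME y. y \<in> X i"]) simp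
  qed
qed

section \<open>Failure for fewer than n(d,eps) sets\<close>

text \<open>By minimality of the vertex bound, some convex set has no good polytope with at most
  \<open>m\<close> vertices. The hull of \<open>m\<close> points has at most \<open>m\<close>
  extreme points, and volume ratios survive scaling to volume 1.\<close>

lemma convex_set_hulls_of_few_points:
  assumes "m < vertex_bound TYPE('d) \<epsilon>"
  obtains K :: "(real ^ 'd) set" where "convex K" "vol K = 1"
    "\<And>S. \<lbrakk>finite S; S \<subseteq> K; card S \<le> m\<rbrakk> \<Longrightarrow> vol (convex hull S) < 1 - \<epsilon>"
proof -
  have "\<exists>K :: (real ^ 'd) set. convex K \<and> K \<in> lmeasurable \<and> vol K > 0 \<and>
      (\<forall>P. polytope P \<and> P \<subseteq> K \<and> card {v. v extreme_point_of P} \<le> m \<longrightarrow> \<not> vol P \<ge> (1 - \<epsilon>) * vol K)"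
    using not_less_Least[OF assms[unfolded vertex_bound_def]] by blast
  then obtain K :: "(real ^ 'd) set" where K: "convex K" "K \<in> lmeasurable" "vol K > 0"
    and no: "\<forall>P. polytope P \<and> P \<subseteq> K \<and> card {v. v extreme_point_of P} \<le> m \<longrightarrow> \<not> vol P \<ge> (1 - \<epsilon>) * vol K"
    by blast
  define s where "s = root CARD('d) (1 / vol K)"
  have s: "s > 0" "s ^ CARD('d) = 1 / vol K" using K(3) by (simp_all add: s_def)
  have scale: "vol ((*\<^sub>R) r ` S) = r ^ CARD('d) * vol S" if "r > 0" for r and S :: "(real ^ 'd) set"
    using measure_lebesgue_affine[of r 0 S] that by simp
  show thesis
  proof
    show "convex ((*\<^sub>R) s ` K)" using K(1) by (rule convex_scaling)
    show "vol ((*\<^sub>R) s ` K) = 1" using scale[OF s(1), of K] s K(3) by simp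
    fix S assume S: "finite S" "S \<subseteq> (*\<^sub>R) s ` K" "card S \<le> m"
    \<comment> \<open>The points are scaled back into the original \<open>K\<close>, where
      minimality applies.\<close>
    let ?T = "(*\<^sub>R) (inverse s) ` S"
    have T: "finite ?T" "?T \<subseteq> K" "card ?T \<le> m"
      using S s card_image_le[OF S(1), of "(*\<^sub>R) (inverse s)"] by (auto simp: image_iff)
    have "card {v. v extreme_point_of convex hull ?T} \<le> m"
      using card_mono[OF T(1) extreme_points_of_convex_hull] T(3) by linarith
    then have less: "vol (convex hull ?T) < (1 - \<epsilon>) * vol K"
      using no[rule_format, of "convex hull ?T"] polytope_convex_hull[OF T(1)]
        hull_minimal[of ?T K convex, OF T(2) K(1)] by simp
    have "S = (*\<^sub>R) s ` ?T" using s by (auto simp: image_image)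
    then have "convex hull S = (*\<^sub>R) s ` (convex hull ?T)" by (metis convex_hull_scaling)
    then have "vol (convex hull S) = vol (convex hull ?T) / vol K"
      using scale[OF s(1), of "convex hull ?T"] s by simp
    also have "\<dots> < 1 - \<epsilon>" using less K(3) by (simp add: field_simps)
    finally show "vol (convex hull S) < 1 - \<epsilon>" .
  qed
qed

theorem theorem2p4:
  fixes \<epsilon> :: real
  assumes "\<epsilon> > 0"
  shows
    "(\<forall>m (X :: nat \<Rightarrow> (real ^ 'd) set) K.
        m = CARD('d) * vertex_bound TYPE('d) \<epsilon> \<and>
        convex K \<and> vol K = 1 \<and> K \<subseteq> (\<Inter>i\<in>{1..m}. convex hull (X i)) \<longrightarrow>
        (\<exists>x. (\<forall>i\<in>{1..m}. x i \<in> X i) \<and> vol (convex hull (x ` {1..m})) \<ge> 1 - \<epsilon>)) \<and>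
     (\<forall>m. 0 < m \<and> m < vertex_bound TYPE('d) \<epsilon> \<longrightarrow>
        (\<exists>(X :: nat \<Rightarrow> (real ^ 'd) set) K.
           convex K \<and> vol K = 1 \<and> K \<subseteq> (\<Inter>i\<in>{1..m}. convex hull (X i)) \<and>
           (\<forall>x. (\<forall>i\<in>{1..m}. x i \<in> X i) \<longrightarrow> vol (convex hull (x ` {1..m})) < 1 - \<epsilon>)))"
proof (rule conjI; intro allI impI; elim conjE)
  fix m and X :: "nat \<Rightarrow> (real ^ 'd) set" and K
  assume "m = CARD('d) * vertex_bound TYPE('d) \<epsilon>" "convex K" "vol K = 1"
    "K \<subseteq> (\<Inter>i\<in>{1..m}. convex hull (X i))"
  then show "\<exists>x. (\<forall>i\<in>{1..m}. x i \<in> X i) \<and> vol (convex hull (x ` {1..m})) \<ge> 1 - \<epsilon>"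
    by (rule colorful_selection_large_volume[OF assms])
next
  fix m assume "m < vertex_bound TYPE('d) \<epsilon>"
  then obtain K :: "(real ^ 'd) set" where K: "convex K" "vol K = 1"
    "\<And>S. \<lbrakk>finite S; S \<subseteq> K; card S \<le> m\<rbrakk> \<Longrightarrow> vol (convex hull S) < 1 - \<epsilon>"
    by (rule convex_set_hulls_of_few_points) blast
  have "vol (convex hull (x ` {1..m})) < 1 - \<epsilon>" if "\<forall>i\<in>{1..m}. x i \<in> K" for x
    using that card_image_le[of "{1..m}" x] by (intro K(3)) auto
  then show "\<exists>(X :: nat \<Rightarrow> (real ^ 'd) set) K.
      convex K \<and> vol K = 1 \<and> K \<subseteq> (\<Inter>i\<in>{1..m}. convex hull (X i)) \<and>
      (\<forall>x. (\<forall>i\<in>{1..m}. x i \<in> X i) \<longrightarrow> vol (convex hull (x ` {1..m})) < 1 - \<epsilon>)"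
    using K by (intro exI[of _ "\<lambda>_. K"] exI[of _ K]) (auto simp: hull_inc)
qed

end
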